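(* Assume that $\mathbb{S}(\Omega)\subset\Omega$. Then, for any two adjacent vertices $[l]\in L(\Omega)$ and $\langle r\rangle\in R(\Omega)$ of $\Gamma(\Omega,q)$: (1) there is an automorphism $\theta_0$ of $\Gamma(\Omega,q)$ such that $\theta_0([l])=[0]_{l_*}$ and $(\theta_0(\langle r\rangle))_*=r_*$; $(\theta_0(\langle r\rangle))_{1^i}=l_*^{i+1}r_*$ whenever $i\ge 0$ and $1^i\in\Omega$; and $(\theta_0(\langle r\rangle))_{\alpha}=0$ for all $\alpha\in\Omega\setminus\{1^i:i\ge 0\}$; (2) there is an automorphism $\theta_1$ of $\Gamma(\Omega,q)$ such that $\theta_1(\langle r\rangle)=\langle 0\rangle_{r_*}$ and $(\theta_1([l]))_*=l_*$; $(\theta_1([l]))_{0^i}=r_*^{i+1}l_*$ whenever $i\ge 0$ and $0^i\in\Omega$; and $(\theta_1([l]))_{\alpha}=0$ for all $\alpha\in\Omega\setminus\{0^i:i\ge 0\}$.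
   Context: Let $q$ be a prime power and $\mathbb{F}_q$ the field with $q$ elements. $\{0,1\}^*$ is the set of finite binary sequences, $\eta$ the null sequence; juxtaposition is concatenation; $\alpha^i$ is the $i$-fold concatenation of $\alpha$ with itself ($\alpha^0=\eta$). $\Omega\subset\{0,1\}^*$ is a finite set satisfying condition C1: $\eta\in\Omega$, and for any $\alpha\in\Omega\setminus\{\eta\}$ the sequence obtained by deleting the last bit of $\alpha$ is in $\Omega$. $L(\Omega)$ and $R(\Omega)$ are two disjoint copies of $\mathbb{F}_q^{|\Omega|+1}$; their vectors are written $[l]$ and $\langle r\rangle$ respectively, with entries indexed by $\Omega\cup\{*\}$, where $*\notin\Omega$ is an extra symbol. $[0]_x\in L(\Omega)$ (resp. $\langle 0\rangle_x\in R(\Omega)$) is the vector whose entry at $*$ is $x$ and all of whose other entries are $0$. $\Gamma(\Omega,q)$ is the bipartite graph with vertex set $L(\Omega)\cup R(\Omega)$ in which $[l]\in L(\Omega)$ and $\langle r\rangle\in R(\Omega)$ are adjacent if and only if $l_\eta+r_\eta=l_*r_*$, $l_{\alpha0}+r_{\alpha0}=r_*l_\alpha$ for all $\alpha0\in\Omega$, and $l_{\beta1}+r_{\beta1}=l_*r_\beta$ for all $\beta1\in\Omega$ (here $\alpha,\beta\in\{0,1\}^*$). For $\alpha\in\Omega$, $S_\Omega(\alpha)$ is the set of $\beta\in\{0,1\}^*$ with $\{\alpha01\beta,\alpha10\beta\}\cap\Omega\ne\emptyset$, and $\mathbb{S}(\Omega)=\bigcup_{\alpha\in\Omega}S_\Omega(\alpha)$.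 *)

theory Defs
  imports "HOL-Library.FuncSet"
begin

(* Binary sequences are boolean lists, with False for the bit 0 and True for the bit 1;
   the null sequence is [] and alpha0 is \<alpha> @ [False].
   Entries are indexed by \<Omega> \<union> {*}: None is the extra symbol * and Some \<alpha> is \<alpha> \<in> \<Omega>.
   A finite field is a type of class {field, finite}; its cardinality q is then
   automatically a prime power, and q ranges over all prime powers as the type varies. *)

type_synonym bits = "bool list"
type_synonym 'a vec = "bits option \<Rightarrow> 'a"

definition condition_C1 :: "bits set \<Rightarrow> bool" where
  "condition_C1 \<Omega> \<longleftrightarrow> [] \<in> \<Omega> \<and> (\<forall>\<alpha> \<in> \<Omega> - {[]}. butlast \<alpha> \<in> \<Omega>)"

definition index_set :: "bits set \<Rightarrow> bits option set" where
  "index_set \<Omega> = insert None (Some ` \<Omega>)"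

(* Extensional functions, so that vectors are determined by their entries. *)
definition vectors :: "bits set \<Rightarrow> 'a vec set" where
  "vectors \<Omega> = index_set \<Omega> \<rightarrow>\<^sub>E UNIV"

(* The vector underlying both [0]_x and <0>_x. *)
definition zero_vec :: "bits set \<Rightarrow> 'a::zero \<Rightarrow> 'a vec" where
  "zero_vec \<Omega> x = (\<lambda>i \<in> index_set \<Omega>. if i = None then x else 0)"

(* The two disjoint copies: LeftV l is [l] and RightV r is <r>. *)
datatype 'a vertex = LeftV "'a vec" | RightV "'a vec"

definition verts :: "bits set \<Rightarrow> 'a vertex set" where
  "verts \<Omega> = LeftV ` vectors \<Omega> \<union> RightV ` vectors \<Omega>"

definition incident :: "bits set \<Rightarrow> 'a::field vec \<Rightarrow> 'a vec \<Rightarrow> bool" where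
  "incident \<Omega> l r \<longleftrightarrow>
     l (Some []) + r (Some []) = l None * r None \<and>
     (\<forall>\<alpha>. \<alpha> @ [False] \<in> \<Omega> \<longrightarrow>
        l (Some (\<alpha> @ [False])) + r (Some (\<alpha> @ [False])) = r None * l (Some \<alpha>)) \<and>
     (\<forall>\<beta>. \<beta> @ [True] \<in> \<Omega> \<longrightarrow>
        l (Some (\<beta> @ [True])) + r (Some (\<beta> @ [True])) = l None * r (Some \<beta>))"

definition edges :: "bits set \<Rightarrow> 'a::field vertex set set" where
  "edges \<Omega> = {{LeftV l, RightV r} | l r.
      l \<in> vectors \<Omega> \<and> r \<in> vectors \<Omega> \<and> incident \<Omega> l r}"

(* Automorphisms of a simple graph with vertex set V and edge set E; the values of the
   map outside V are irrelevant. *)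
definition graph_automorphism :: "'v set \<Rightarrow> 'v set set \<Rightarrow> ('v \<Rightarrow> 'v) \<Rightarrow> bool" where
  "graph_automorphism V E \<theta> \<longleftrightarrow>
     bij_betw \<theta> V V \<and> (\<forall>u\<in>V. \<forall>v\<in>V. {\<theta> u, \<theta> v} \<in> E \<longleftrightarrow> {u, v} \<in> E)"

definition S_at :: "bits set \<Rightarrow> bits \<Rightarrow> bits set" where
  "S_at \<Omega> \<alpha> = {\<beta>. {\<alpha> @ [False, True] @ \<beta>, \<alpha> @ [True, False] @ \<beta>} \<inter> \<Omega> \<noteq> {}}"

definition S_total :: "bits set \<Rightarrow> bits set" where
  "S_total \<Omega> = (\<Union>\<alpha>\<in>\<Omega>. S_at \<Omega> \<alpha>)"

end

theory Submission
  imports Defs "HOL-Library.Sublist"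
begin

text \<open>
  A neighbour of a vertex is determined by that vertex and the neighbour's own entry at \<open>*\<close>, because
  the defining equations give its entries one after the other. It therefore suffices to find
  automorphisms that fix all entries at \<open>*\<close> and that take an arbitrary vertex to the vector with the
  same entry at \<open>*\<close> and zeros elsewhere; the other end of the edge is then obtained by solving the
  equations (\<open>neighbour_of_zero_vec\<close>).

  Such automorphisms are composed of elementary ones, one for each \<open>\<alpha> \<in> \<Omega>\<close> and each scalar \<open>x\<close>.
  Add \<open>x\<close> to \<open>l\<^sub>\<alpha>\<close> and subtract \<open>x\<close> from \<open>r\<^sub>\<alpha>\<close>. The equations at \<open>\<alpha>0\<close> and \<open>\<alpha>1\<close> are
  repaired by adding \<open>x r\<^sub>*\<close> to \<open>r\<close> at \<open>\<alpha>0\<close> and \<open>-x l\<^sub>*\<close> to \<open>l\<close> at \<open>\<alpha>1\<close>. One level further, \<open>\<alpha>00\<close>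
  and \<open>\<alpha>11\<close> need no correction, whereas the equations at \<open>\<alpha>01\<close> and \<open>\<alpha>10\<close> are disturbed by
  \<open>\<plusminus>x l\<^sub>* r\<^sub>*\<close>. On an edge this is \<open>\<plusminus>x (l\<^sub>\<eta> + r\<^sub>\<eta>)\<close>, which splits into a part that depends on \<open>l\<close>
  alone and one that depends on \<open>r\<close> alone. From there on the pattern reproduces
  itself: the corrections at \<open>\<alpha>01\<beta>\<close> and \<open>\<alpha>10\<beta>\<close> are \<open>\<plusminus>x\<close> times the entries at \<open>\<beta>\<close>, and they are
  consistent because \<open>l\<close> and \<open>r\<close> satisfy the equation at \<open>\<beta>\<close>, which requires \<open>\<beta> \<in> \<Omega>\<close>. This is
  what the hypothesis \<open>S_total \<Omega> \<subseteq> \<Omega>\<close> provides (\<open>adj_translate\<close>).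

  The elementary map changes an entry by a function of the entry at \<open>*\<close> and of entries at shorter
  sequences, so it is injective, and as the graph is finite it is an automorphism. It changes only
  entries at extensions of \<open>\<alpha>\<close>. Hence the entries of a vector can be cleared in order of increasing
  length, without spoiling those that are already zero (\<open>exists_automorphism_clearing\<close>).

  Exchanging the two sides together with the bits \<open>0\<close> and \<open>1\<close> preserves the equations. Everything
  is therefore stated for a side given by a bit \<open>b\<close>, where \<open>True\<close> stands for the left; the two
  halves of the result are the two values of \<open>b\<close>.
\<close>

section \<open>Exchanging the two sides\<close>

definition side :: "bool \<Rightarrow> 'a vec \<Rightarrow> 'a vertex" where
  "side b v = (if b then LeftV v else RightV v)"

text \<open>
  Incidence as seen from side \<open>b\<close>: an equation at a sequence \<open>\<beta>b\<close> has the right-hand side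
  \<open>l\<^sub>* r\<^sub>\<beta>\<close> for \<open>b = True\<close> and \<open>r\<^sub>* l\<^sub>\<beta>\<close> for \<open>b = False\<close>, so that the factor at \<open>*\<close> always belongs
  to side \<open>b\<close>.
\<close>
definition adj :: "bool \<Rightarrow> bits set \<Rightarrow> 'a::field vec \<Rightarrow> 'a vec \<Rightarrow> bool" where
  "adj b \<Omega> u v \<longleftrightarrow>
     u (Some []) + v (Some []) = u None * v None \<and>
     (\<forall>\<alpha>. \<alpha> @ [\<not> b] \<in> \<Omega> \<longrightarrow>
        u (Some (\<alpha> @ [\<not> b])) + v (Some (\<alpha> @ [\<not> b])) = v None * u (Some \<alpha>)) \<and>
     (\<forall>\<beta>. \<beta> @ [b] \<in> \<Omega> \<longrightarrow>
        u (Some (\<beta> @ [b])) + v (Some (\<beta> @ [b])) = u None * v (Some \<beta>))"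

lemma adj_True: "adj True \<Omega> u v \<longleftrightarrow> incident \<Omega> u v"
  by (simp add: adj_def incident_def)

lemma adj_swap: "adj (\<not> b) \<Omega> v u \<longleftrightarrow> adj b \<Omega> u v"
  by (auto simp: adj_def ac_simps)

lemma side_eq_iff [simp]: "side b u = side c v \<longleftrightarrow> b = c \<and> u = v"
  by (simp add: side_def)

lemma verts_cases:
  assumes "w \<in> verts \<Omega>"
  obtains b v where "v \<in> vectors \<Omega>" and "w = side b v"
proof -
  from assms consider v where "v \<in> vectors \<Omega>" "w = LeftV v"
    | v where "v \<in> vectors \<Omega>" "w = RightV v"
    by (auto simp: verts_def)
  then show thesis
  proof cases
    case 1
    then show thesis using that[of _ True] by (simp add: side_def)
  next
    case 2
    then show thesis using that[of _ False] by (simp add: side_def)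
  qed
qed

lemma side_in_verts: "v \<in> vectors \<Omega> \<Longrightarrow> side b v \<in> verts \<Omega>"
  by (simp add: side_def verts_def)

lemma side_in_edges_iff:
  "{side b u, side (\<not> b) v} \<in> edges \<Omega> \<longleftrightarrow> u \<in> vectors \<Omega> \<and> v \<in> vectors \<Omega> \<and> adj b \<Omega> u v"
proof -
  have L: "{LeftV l, RightV r} \<in> edges \<Omega> \<longleftrightarrow>
      l \<in> vectors \<Omega> \<and> r \<in> vectors \<Omega> \<and> adj True \<Omega> l r" for l r :: "'a vec"
    by (auto simp: edges_def doubleton_eq_iff adj_True)
  show ?thesis
  proof (cases b)
    case True
    then show ?thesis using L by (simp add: side_def)
  next
    case False
    then have "{side b u, side (\<not> b) v} = {LeftV v, RightV u}"
      by (auto simp: side_def)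
    then show ?thesis using False L[of v u] adj_swap[of False \<Omega> v u] by auto
  qed
qed

lemma edges_cases:
  assumes "e \<in> edges \<Omega>"
  obtains u v where "e = {side True u, side False v}"
    and "u \<in> vectors \<Omega>" and "v \<in> vectors \<Omega>" and "adj True \<Omega> u v"
  using assms by (auto simp: edges_def side_def adj_True)

section \<open>Vectors\<close>

lemma Some_in_index_set [simp]: "Some \<alpha> \<in> index_set \<Omega> \<longleftrightarrow> \<alpha> \<in> \<Omega>"
  by (auto simp: index_set_def)

lemma None_in_index_set [simp]: "None \<in> index_set \<Omega>"
  by (simp add: index_set_def)

lemma vectors_eqI:
  assumes "u \<in> vectors \<Omega>" and "v \<in> vectors \<Omega>"
    and "u None = v None" and "\<And>\<alpha>. \<alpha> \<in> \<Omega> \<Longrightarrow> u (Some \<alpha>) = v (Some \<alpha>)"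
  shows "u = v"
  using assms(1,2) unfolding vectors_def
proof (rule PiE_ext)
  fix i
  assume "i \<in> index_set \<Omega>"
  then show "u i = v i"
    using assms(3,4) by (cases i) auto
qed

lemma vectors_outside: "v \<in> vectors \<Omega> \<Longrightarrow> \<alpha> \<notin> \<Omega> \<Longrightarrow> v (Some \<alpha>) = undefined"
  unfolding vectors_def by (rule PiE_arb) auto

lemma zero_vec_in_vectors: "zero_vec \<Omega> x \<in> vectors \<Omega>"
  by (simp add: zero_vec_def vectors_def)

lemma finite_verts:
  assumes "finite \<Omega>"
  shows "finite (verts \<Omega> :: 'a::finite vertex set)"
proof -
  have "finite (vectors \<Omega> :: 'a vec set)"
    unfolding vectors_def using assms by (intro finite_PiE) (auto simp: index_set_def)
  then show ?thesis by (simp add: verts_def)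
qed

section \<open>Automorphisms of finite graphs\<close>

text \<open>
  An injective self-map of a finite graph that preserves edges also permutes the finite set of
  edges, so it cannot turn a non-edge into an edge.
\<close>
lemma graph_automorphism_finiteI:
  assumes fin: "finite V" and E: "E \<subseteq> Pow V"
    and inj: "inj_on \<theta> V" and V: "\<theta> ` V \<subseteq> V"
    and pres: "\<And>e. e \<in> E \<Longrightarrow> \<theta> ` e \<in> E"
  shows "graph_automorphism V E \<theta>"
  unfolding graph_automorphism_def
proof (intro conjI ballI)
  show "bij_betw \<theta> V V"
    using endo_inj_surj[OF fin V inj] inj by (simp add: bij_betw_def)
  have surj: "image \<theta> ` E = E"
  proof (rule endo_inj_surj)
    show "finite E" using fin E by (meson finite_Pow_iff finite_subset)
    show "image \<theta> ` E \<subseteq> E" using pres by blast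
    show "inj_on (image \<theta>) E"
      using inj_on_image_Pow[OF inj] E by (rule inj_on_subset)
  qed
  fix u v
  assume uv: "u \<in> V" "v \<in> V"
  show "{\<theta> u, \<theta> v} \<in> E \<longleftrightarrow> {u, v} \<in> E"
  proof
    assume "{\<theta> u, \<theta> v} \<in> E"
    then have "\<theta> ` {u, v} \<in> image \<theta> ` E"
      by (simp only: surj image_insert image_empty)
    then obtain e where e: "e \<in> E" "\<theta> ` e = \<theta> ` {u, v}"
      by (metis imageE)
    have "e \<subseteq> V" "{u, v} \<subseteq> V"
      using e(1) E uv by auto
    then have "e = {u, v}"
      using inj_on_image_eq_iff[OF inj] e(2) by blast
    then show "{u, v} \<in> E" using e by simp
  next
    assume "{u, v} \<in> E"
    from pres[OF this] show "{\<theta> u, \<theta> v} \<in> E" by simp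
  qed
qed

lemma graph_automorphism_comp:
  assumes "graph_automorphism V E f" and "graph_automorphism V E g"
  shows "graph_automorphism V E (g \<circ> f)"
proof -
  have "f u \<in> V" if "u \<in> V" for u
    using assms(1) that by (auto simp: graph_automorphism_def bij_betw_def)
  then show ?thesis
    using assms by (auto simp: graph_automorphism_def intro: bij_betw_trans)
qed

text \<open>The automorphisms that respect the two sides and fix all entries at \<open>*\<close>.\<close>
definition star_automorphism :: "bits set \<Rightarrow> ('a::field vertex \<Rightarrow> 'a vertex) \<Rightarrow> bool" where
  "star_automorphism \<Omega> \<theta> \<longleftrightarrow> graph_automorphism (verts \<Omega>) (edges \<Omega>) \<theta> \<and>
     (\<forall>b. \<forall>v \<in> vectors \<Omega>. \<exists>w \<in> vectors \<Omega>. \<theta> (side b v) = side b w \<and> w None = v None)"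

lemma star_automorphism_id: "star_automorphism \<Omega> id"
  by (auto simp: star_automorphism_def graph_automorphism_def)

lemma star_automorphism_comp:
  assumes "star_automorphism \<Omega> f" and "star_automorphism \<Omega> g"
  shows "star_automorphism \<Omega> (g \<circ> f)"
  unfolding star_automorphism_def
proof (intro conjI allI ballI)
  show "graph_automorphism (verts \<Omega>) (edges \<Omega>) (g \<circ> f)"
    using assms by (intro graph_automorphism_comp) (simp_all add: star_automorphism_def)
  fix b and v :: "'a vec"
  assume "v \<in> vectors \<Omega>"
  with assms(1) obtain w where w: "w \<in> vectors \<Omega>" "f (side b v) = side b w" "w None = v None"
    unfolding star_automorphism_def by blast
  with assms(2) obtain w' where "w' \<in> vectors \<Omega>" "g (side b w) = side b w'" "w' None = w None"
    unfolding star_automorphism_def by blast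
  with w show "\<exists>w\<in>vectors \<Omega>. (g \<circ> f) (side b v) = side b w \<and> w None = v None"
    by auto
qed

section \<open>Translating one entry\<close>

text \<open>
  The correction, on a vector of side \<open>b\<close>, at the sequence that continues \<open>\<alpha>\<close> by the given suffix
  when the entry at \<open>\<alpha>\<close> is increased by \<open>x\<close>. The other side carries the corrections for
  \<open>\<not> b\<close> and \<open>-x\<close>; at \<open>\<alpha>01\<beta>\<close> and \<open>\<alpha>10\<beta>\<close> these are the same multiple of the entry at \<open>\<beta>\<close>, since
  both the sign and the roles of the bits change.
\<close>
fun correction :: "bool \<Rightarrow> 'a::field \<Rightarrow> 'a vec \<Rightarrow> bits \<Rightarrow> 'a" where
  "correction b x v [] = x"
| "correction b x v [c] = (if c = b then - x * v None else 0)"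
| "correction b x v (c # d # \<beta>) =
     (if c = d then 0 else if c = b then - x * v (Some \<beta>) else x * v (Some \<beta>))"

lemma correction_cong:
  assumes "u None = v None"
    and "\<And>\<beta>. length \<beta> < length \<gamma> \<Longrightarrow> u (Some \<beta>) = v (Some \<beta>)"
  shows "correction b x u \<gamma> = correction b x v \<gamma>"
  using assms by (cases "(b, x, v, \<gamma>)" rule: correction.cases) auto

text \<open>
  On an edge the product \<open>x u\<^sub>* v\<^sub>*\<close> of the second step equals \<open>x (u\<^sub>\<eta> + v\<^sub>\<eta>)\<close>; for longer suffixes
  the claim is the equation of the edge at \<open>\<beta>\<close>, multiplied by \<open>\<plusminus>x\<close>.
\<close>
lemma correction_snoc_Not:
  assumes adj: "adj b \<Omega> u v"
    and suffix: "\<And>c \<beta>. \<gamma> @ [\<not> b] = c # (\<not> c) # \<beta> \<Longrightarrow> \<beta> \<in> \<Omega>"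
  shows "correction b x u (\<gamma> @ [\<not> b]) + correction (\<not> b) (- x) v (\<gamma> @ [\<not> b])
           = v None * correction b x u \<gamma>"
proof (cases "(b, x, u, \<gamma>)" rule: correction.cases)
  case 1
  then show ?thesis by simp
next
  case (2 b' x' v' c)
  have "u (Some []) + v (Some []) = u None * v None"
    using adj by (simp add: adj_def)
  then have "- (x * u (Some [])) - x * v (Some []) = - (x * (u None * v None))"
    by (metis distrib_left minus_add_distrib diff_conv_add_uminus)
  then show ?thesis using 2 by (auto simp: algebra_simps)
next
  case (3 b' x' v' c d \<beta>)
  show ?thesis
  proof (cases "c = d")
    case True
    then show ?thesis using 3 by simp
  next
    case False
    then have "\<beta> @ [\<not> b] \<in> \<Omega>" using suffix[of c] 3 by auto
    then have "u (Some (\<beta> @ [\<not> b])) + v (Some (\<beta> @ [\<not> b])) = v None * u (Some \<beta>)"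
      using adj by (simp add: adj_def)
    then have *: "x * u (Some (\<beta> @ [\<not> b])) + x * v (Some (\<beta> @ [\<not> b])) = v None * (x * u (Some \<beta>))"
      by (metis distrib_left mult.left_commute)
    have "- (x * u (Some (\<beta> @ [\<not> b]))) - x * v (Some (\<beta> @ [\<not> b])) = - (v None * (x * u (Some \<beta>)))"
      unfolding *[symmetric] by simp
    with * show ?thesis using False 3 by (cases b; cases c) simp_all
  qed
qed

definition translate :: "bits set \<Rightarrow> bool \<Rightarrow> bits \<Rightarrow> 'a::field \<Rightarrow> 'a vec \<Rightarrow> 'a vec" where
  "translate \<Omega> b \<alpha> x v = (\<lambda>i \<in> index_set \<Omega>. case i of None \<Rightarrow> v None
     | Some \<gamma> \<Rightarrow> v (Some \<gamma>) +
         (if prefix \<alpha> \<gamma> then correction b x v (drop (length \<alpha>) \<gamma>) else 0))"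

lemma translate_None [simp]: "translate \<Omega> b \<alpha> x v None = v None"
  by (simp add: translate_def)

lemma translate_Some:
  "\<gamma> \<in> \<Omega> \<Longrightarrow> translate \<Omega> b \<alpha> x v (Some \<gamma>) =
     v (Some \<gamma>) + (if prefix \<alpha> \<gamma> then correction b x v (drop (length \<alpha>) \<gamma>) else 0)"
  by (simp add: translate_def)

lemma translate_in_vectors: "translate \<Omega> b \<alpha> x v \<in> vectors \<Omega>"
  by (simp add: translate_def vectors_def)

text \<open>
  The map is unitriangular with respect to the length of the index, so the entries of the argument
  can be recovered in order of increasing length.
\<close>
lemma inj_on_translate: "inj_on (translate \<Omega> b \<alpha> x) (vectors \<Omega>)"
proof (rule inj_onI)
  fix u v :: "'a vec"
  assume uv: "u \<in> vectors \<Omega>" "v \<in> vectors \<Omega>"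
    and eq: "translate \<Omega> b \<alpha> x u = translate \<Omega> b \<alpha> x v"
  have N: "u None = v None"
    using fun_cong[OF eq, of None] by simp
  have S: "u (Some \<gamma>) = v (Some \<gamma>)" for \<gamma>
  proof (induction \<gamma> rule: length_induct)
    case (1 \<gamma>)
    show ?case
    proof (cases "\<gamma> \<in> \<Omega>")
      case True
      have "correction b x u (drop (length \<alpha>) \<gamma>) = correction b x v (drop (length \<alpha>) \<gamma>)"
        using N 1 by (intro correction_cong) auto
      with fun_cong[OF eq, of "Some \<gamma>"] True show ?thesis
        by (auto simp: translate_Some split: if_splits)
    next
      case False
      then show ?thesis using uv by (simp add: vectors_outside)
    qed
  qed
  show "u = v" using uv N S by (rule vectors_eqI)
qed

lemma translate_snoc_Not:
  assumes adj: "adj b \<Omega> u v" and C1: "condition_C1 \<Omega>" and S: "S_total \<Omega> \<subseteq> \<Omega>"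
    and \<alpha>: "\<alpha> \<in> \<Omega>" and \<gamma>: "\<gamma> @ [\<not> b] \<in> \<Omega>"
  shows "translate \<Omega> b \<alpha> x u (Some (\<gamma> @ [\<not> b])) + translate \<Omega> (\<not> b) \<alpha> (- x) v (Some (\<gamma> @ [\<not> b]))
    = v None * translate \<Omega> b \<alpha> x u (Some \<gamma>)"
proof -
  have \<gamma>': "\<gamma> \<in> \<Omega>"
    using C1 \<gamma> unfolding condition_C1_def by force
  have uv: "u (Some (\<gamma> @ [\<not> b])) + v (Some (\<gamma> @ [\<not> b])) = v None * u (Some \<gamma>)"
    using adj \<gamma> by (simp add: adj_def)
  consider (proper) \<delta> where "\<gamma> = \<alpha> @ \<delta>" | (equal) "\<alpha> = \<gamma> @ [\<not> b]"
    | (no) "\<not> prefix \<alpha> (\<gamma> @ [\<not> b])"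
    by (metis prefix_snoc prefixE)
  then show ?thesis
  proof cases
    case proper
    have suffix: "\<beta> \<in> \<Omega>" if "\<delta> @ [\<not> b] = c # (\<not> c) # \<beta>" for c \<beta>
    proof -
      have "\<alpha> @ [c, \<not> c] @ \<beta> \<in> \<Omega>" using \<gamma> proper that by simp
      then have "\<beta> \<in> S_at \<Omega> \<alpha>" by (cases c) (auto simp: S_at_def)
      then show ?thesis using \<alpha> S by (auto simp: S_total_def)
    qed
    have "correction b x u (\<delta> @ [\<not> b]) + correction (\<not> b) (- x) v (\<delta> @ [\<not> b])
        = v None * correction b x u \<delta>"
      by (rule correction_snoc_Not[OF adj]) (rule suffix)
    moreover have "(p + s) + (q + t) = k * (m + n)" if "p + q = k * m" "s + t = k * n"
      for p q s t k m n :: 'a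
      by (simp add: distrib_left ac_simps flip: that)
    ultimately show ?thesis using uv \<gamma> \<gamma>' proper by (simp add: translate_Some)
  next
    case equal
    then have "\<not> prefix \<alpha> \<gamma>" by (auto simp: prefix_def)
    then show ?thesis using \<gamma> \<gamma>' equal uv by (simp add: translate_Some)
  next
    case no
    then have "\<not> prefix \<alpha> \<gamma>" by auto
    then show ?thesis using \<gamma> \<gamma>' no uv by (simp add: translate_Some)
  qed
qed

text \<open>
  The equations at sequences ending in \<open>b\<close> are those at sequences ending in \<open>\<not> b\<close>, seen from the
  other side.
\<close>
lemma adj_translate:
  assumes adj: "adj b \<Omega> u v" and C1: "condition_C1 \<Omega>" and S: "S_total \<Omega> \<subseteq> \<Omega>" and \<alpha>: "\<alpha> \<in> \<Omega>"
  shows "adj b \<Omega> (translate \<Omega> b \<alpha> x u) (translate \<Omega> (\<not> b) \<alpha> (- x) v)"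
proof -
  have adj': "adj (\<not> b) \<Omega> v u" using adj by (simp add: adj_swap)
  have "[] \<in> \<Omega>" using C1 by (simp add: condition_C1_def)
  then have "translate \<Omega> b \<alpha> x u (Some []) + translate \<Omega> (\<not> b) \<alpha> (- x) v (Some []) = u None * v None"
    using adj by (simp add: translate_Some adj_def)
  moreover have "translate \<Omega> b \<alpha> x u (Some (\<beta> @ [b])) + translate \<Omega> (\<not> b) \<alpha> (- x) v (Some (\<beta> @ [b]))
      = u None * translate \<Omega> (\<not> b) \<alpha> (- x) v (Some \<beta>)" if "\<beta> @ [b] \<in> \<Omega>" for \<beta>
    using translate_snoc_Not[OF adj' C1 S \<alpha>, of \<beta> "- x"] that by (simp add: add.commute)
  ultimately show ?thesis
    using translate_snoc_Not[OF adj C1 S \<alpha>] by (subst adj_def) simp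
qed

fun translate_vertex :: "bits set \<Rightarrow> bits \<Rightarrow> 'a::field \<Rightarrow> 'a vertex \<Rightarrow> 'a vertex" where
  "translate_vertex \<Omega> \<alpha> x (LeftV v) = LeftV (translate \<Omega> True \<alpha> x v)"
| "translate_vertex \<Omega> \<alpha> x (RightV v) = RightV (translate \<Omega> False \<alpha> (- x) v)"

lemma translate_vertex_side:
  "translate_vertex \<Omega> \<alpha> x (side b v) = side b (translate \<Omega> b \<alpha> (if b then x else - x) v)"
  by (simp add: side_def)

lemma star_automorphism_translate_vertex:
  fixes x :: "'a::{field,finite}"
  assumes "finite \<Omega>" and C1: "condition_C1 \<Omega>" and S: "S_total \<Omega> \<subseteq> \<Omega>" and \<alpha>: "\<alpha> \<in> \<Omega>"
  shows "star_automorphism \<Omega> (translate_vertex \<Omega> \<alpha> x)"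
  unfolding star_automorphism_def
proof (intro conjI allI ballI)
  let ?t = "translate_vertex \<Omega> \<alpha> x"
  show "graph_automorphism (verts \<Omega>) (edges \<Omega>) ?t"
  proof (rule graph_automorphism_finiteI)
    show "finite (verts \<Omega> :: 'a vertex set)" using assms(1) by (rule finite_verts)
    show "edges \<Omega> \<subseteq> Pow (verts \<Omega> :: 'a vertex set)"
      by (auto simp: edges_def verts_def)
    show "inj_on ?t (verts \<Omega>)"
    proof (rule inj_onI)
      fix w w' :: "'a vertex"
      assume "w \<in> verts \<Omega>" "w' \<in> verts \<Omega>" and eq: "?t w = ?t w'"
      then obtain b v b' v' where v: "v \<in> vectors \<Omega>" "v' \<in> vectors \<Omega>"
        and w: "w = side b v" "w' = side b' v'"
        by (metis verts_cases)
      from eq have "b' = b"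
        "translate \<Omega> b \<alpha> (if b then x else - x) v = translate \<Omega> b \<alpha> (if b then x else - x) v'"
        by (auto simp: w translate_vertex_side)
      with v show "w = w'" using inj_onD[OF inj_on_translate] w by blast
    qed
    show "?t ` verts \<Omega> \<subseteq> verts \<Omega>"
    proof
      fix w
      assume "w \<in> ?t ` verts \<Omega>"
      then show "w \<in> verts \<Omega>"
        by (auto elim!: verts_cases simp: translate_vertex_side side_in_verts translate_in_vectors)
    qed
    fix e :: "'a vertex set"
    assume "e \<in> edges \<Omega>"
    then obtain u v where e: "e = {side True u, side False v}" and "adj True \<Omega> u v"
      by (rule edges_cases)
    then have "adj True \<Omega> (translate \<Omega> True \<alpha> x u) (translate \<Omega> False \<alpha> (- x) v)"
      using adj_translate[of True \<Omega> u v \<alpha> x] C1 S \<alpha> by simp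
    then show "?t ` e \<in> edges \<Omega>"
      using side_in_edges_iff[of True "translate \<Omega> True \<alpha> x u" "translate \<Omega> False \<alpha> (- x) v" \<Omega>]
      by (simp add: e translate_vertex_side translate_in_vectors)
  qed
next
  fix b and v :: "'a vec"
  show "\<exists>w\<in>vectors \<Omega>. translate_vertex \<Omega> \<alpha> x (side b v) = side b w \<and> w None = v None"
    by (auto simp: translate_vertex_side translate_in_vectors)
qed

section \<open>Clearing all entries of a vector\<close>

text \<open>
  The sequences in \<open>A\<close> are treated in order of increasing length. The translation that clears the
  entry at the last of them, \<open>\<alpha>\<close>, leaves the entries treated before it alone, as none of
  their indices extends \<open>\<alpha>\<close>.
\<close>
lemma exists_automorphism_clearing:
  fixes v :: "'a::{field,finite} vec"
  assumes "finite \<Omega>" and "condition_C1 \<Omega>" and "S_total \<Omega> \<subseteq> \<Omega>"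
    and v: "v \<in> vectors \<Omega>" and "finite A" and "A \<subseteq> \<Omega>"
  shows "\<exists>\<theta> w. star_automorphism \<Omega> \<theta> \<and> w \<in> vectors \<Omega> \<and> \<theta> (side b v) = side b w \<and>
    w None = v None \<and> (\<forall>\<gamma>\<in>A. w (Some \<gamma>) = 0)"
  using \<open>finite A\<close> \<open>A \<subseteq> \<Omega>\<close>
proof (induction A rule: finite_ranking_induct[where f = length])
  case empty
  show ?case using star_automorphism_id v by (metis id_apply empty_iff)
next
  case (insert \<alpha> A)
  show ?case
  proof (cases "\<alpha> \<in> A")
    case True
    then show ?thesis using insert by (simp add: insert_absorb)
  next
    case False
    from insert obtain \<theta> w where \<theta>: "star_automorphism \<Omega> \<theta>" "\<theta> (side b v) = side b w"
      and w: "w None = v None" "\<forall>\<gamma>\<in>A. w (Some \<gamma>) = 0"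
      by blast
    have \<alpha>: "\<alpha> \<in> \<Omega>" using insert by simp
    (* The parameter of translate_vertex is the change on the left; the right moves by its negative. *)
    define x where "x = (if b then - w (Some \<alpha>) else w (Some \<alpha>))"
    define w' where "w' = translate \<Omega> b \<alpha> (- w (Some \<alpha>)) w"
    have "star_automorphism \<Omega> (translate_vertex \<Omega> \<alpha> x \<circ> \<theta>)"
      using \<theta>(1) assms \<alpha> by (intro star_automorphism_comp star_automorphism_translate_vertex)
    moreover have "(translate_vertex \<Omega> \<alpha> x \<circ> \<theta>) (side b v) = side b w'"
      by (simp add: \<theta> translate_vertex_side x_def w'_def)
    moreover have "w' (Some \<gamma>) = 0" if "\<gamma> \<in> insert \<alpha> A" for \<gamma>
    proof (cases "\<gamma> = \<alpha>")
      case True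
      then show ?thesis using \<alpha> by (simp add: w'_def translate_Some)
    next
      case False
      then have "\<gamma> \<in> A" using that by simp
      then have "length \<gamma> \<le> length \<alpha>" using insert.hyps(2) by simp
      then have "\<not> prefix \<alpha> \<gamma>" using \<open>\<gamma> \<noteq> \<alpha>\<close> by (auto simp: prefix_def)
      then show ?thesis using \<open>\<gamma> \<in> A\<close> insert.prems w by (auto simp: w'_def translate_Some)
    qed
    ultimately show ?thesis
      using w(1) translate_None translate_in_vectors unfolding w'_def by metis
  qed
qed

text \<open>
  With \<open>u = zero_vec \<Omega> x\<close> the equations read \<open>v\<^sub>\<eta> = x v\<^sub>*\<close>, \<open>v\<^sub>\<gamma> = 0\<close> if \<open>\<gamma>\<close> ends in \<open>\<not> b\<close>, and
  \<open>v\<^sub>\<gamma> = x v\<^sub>\<beta>\<close> if \<open>\<gamma> = \<beta>b\<close>.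
\<close>
lemma neighbour_of_zero_vec:
  assumes adj: "adj b \<Omega> (zero_vec \<Omega> x) v" and C1: "condition_C1 \<Omega>" and "\<gamma> \<in> \<Omega>"
  shows "v (Some \<gamma>) = (if set \<gamma> \<subseteq> {b} then x ^ (length \<gamma> + 1) * v None else 0)"
  using \<open>\<gamma> \<in> \<Omega>\<close>
proof (induction \<gamma> rule: rev_induct)
  case Nil
  then show ?case using adj by (simp add: adj_def zero_vec_def)
next
  case (snoc c \<gamma>)
  have \<gamma>: "\<gamma> \<in> \<Omega>"
    using C1 snoc.prems unfolding condition_C1_def by force
  show ?case
  proof (cases "c = b")
    case True
    then have "v (Some (\<gamma> @ [c])) = x * v (Some \<gamma>)"
      using adj snoc.prems by (simp add: adj_def zero_vec_def)
    then show ?thesis using True snoc.IH[OF \<gamma>] by simp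
  next
    case False
    then have "c = (\<not> b)" by simp
    then have "v (Some (\<gamma> @ [c])) = 0"
      using adj snoc.prems \<gamma> by (simp add: adj_def zero_vec_def)
    then show ?thesis using False by simp
  qed
qed

lemma exists_normalising_automorphism:
  fixes u v :: "'a::{field,finite} vec"
  assumes "finite \<Omega>" and C1: "condition_C1 \<Omega>" and "S_total \<Omega> \<subseteq> \<Omega>"
    and u: "u \<in> vectors \<Omega>" and v: "v \<in> vectors \<Omega>"
    and edge: "{side b u, side (\<not> b) v} \<in> edges \<Omega>"
  shows "\<exists>\<theta> w. graph_automorphism (verts \<Omega>) (edges \<Omega>) \<theta>
    \<and> \<theta> (side b u) = side b (zero_vec \<Omega> (u None))
    \<and> \<theta> (side (\<not> b) v) = side (\<not> b) w
    \<and> w None = v None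
    \<and> (\<forall>i. replicate i b \<in> \<Omega> \<longrightarrow> w (Some (replicate i b)) = u None ^ (i + 1) * v None)
    \<and> (\<forall>\<alpha> \<in> \<Omega> - {replicate i b | i. True}. w (Some \<alpha>) = 0)"
proof -
  obtain \<theta> u' where \<theta>: "star_automorphism \<Omega> \<theta>" "\<theta> (side b u) = side b u'"
    and u': "u' \<in> vectors \<Omega>" "u' None = u None" "\<forall>\<gamma>\<in>\<Omega>. u' (Some \<gamma>) = 0"
    using exists_automorphism_clearing[OF assms(1-3) u assms(1) subset_refl] by blast
  have zero: "u' = zero_vec \<Omega> (u None)"
    using u' zero_vec_in_vectors by (rule_tac vectors_eqI) (auto simp: zero_vec_def)
  obtain w where w: "\<theta> (side (\<not> b) v) = side (\<not> b) w" "w None = v None"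
    using \<theta>(1) v unfolding star_automorphism_def by blast
  have auto: "graph_automorphism (verts \<Omega>) (edges \<Omega>) \<theta>"
    using \<theta>(1) by (simp add: star_automorphism_def)
  then have "{\<theta> (side b u), \<theta> (side (\<not> b) v)} \<in> edges \<Omega>"
    using edge u v side_in_verts unfolding graph_automorphism_def by blast
  then have "adj b \<Omega> (zero_vec \<Omega> (u None)) w"
    by (simp add: \<theta>(2) w(1) zero side_in_edges_iff)
  note entry = neighbour_of_zero_vec[OF this C1, unfolded w(2)]
  have powers: "w (Some (replicate i b)) = u None ^ (i + 1) * v None" if "replicate i b \<in> \<Omega>" for i
    using entry[OF that] by auto
  have others: "w (Some \<alpha>) = 0" if "\<alpha> \<in> \<Omega> - {replicate i b | i. True}" for \<alpha>
  proof -
    have "\<not> set \<alpha> \<subseteq> {b}"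
      using that replicate_eqI[of \<alpha> "length \<alpha>" b] by blast
    then show ?thesis using entry[of \<alpha>] that by simp
  qed
  show ?thesis
    using auto \<theta>(2) zero w powers others by (intro exI[of _ \<theta>] exI[of _ w]) simp
qed

theorem theorem1:
  fixes \<Omega> :: "bits set"
    and l r :: "'a::{field,finite} vec"
  assumes "finite \<Omega>"
    and "condition_C1 \<Omega>"
    and "S_total \<Omega> \<subseteq> \<Omega>"
    and "l \<in> vectors \<Omega>" and "r \<in> vectors \<Omega>"
    and "{LeftV l, RightV r} \<in> edges \<Omega>"
  shows "(\<exists>\<theta>\<^sub>0 r'. graph_automorphism (verts \<Omega>) (edges \<Omega>) \<theta>\<^sub>0
            \<and> \<theta>\<^sub>0 (LeftV l) = LeftV (zero_vec \<Omega> (l None))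
            \<and> \<theta>\<^sub>0 (RightV r) = RightV r'
            \<and> r' None = r None
            \<and> (\<forall>i. replicate i True \<in> \<Omega> \<longrightarrow>
                  r' (Some (replicate i True)) = l None ^ (i + 1) * r None)
            \<and> (\<forall>\<alpha> \<in> \<Omega> - {replicate i True | i. True}. r' (Some \<alpha>) = 0))
       \<and> (\<exists>\<theta>\<^sub>1 l'. graph_automorphism (verts \<Omega>) (edges \<Omega>) \<theta>\<^sub>1
            \<and> \<theta>\<^sub>1 (RightV r) = RightV (zero_vec \<Omega> (r None))
            \<and> \<theta>\<^sub>1 (LeftV l) = LeftV l'
            \<and> l' None = l None
            \<and> (\<forall>i. replicate i False \<in> \<Omega> \<longrightarrow>
                  l' (Some (replicate i False)) = r None ^ (i + 1) * l None)
            \<and> (\<forall>\<alpha> \<in> \<Omega> - {replicate i False | i. True}. l' (Some \<alpha>) = 0))"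
proof (rule conjI, goal_cases)
  case 1
  show ?case
    using exists_normalising_automorphism[of \<Omega> l r True] assms by (simp add: side_def)
next
  case 2
  show ?case
    using exists_normalising_automorphism[of \<Omega> r l False] assms
    by (simp add: side_def insert_commute)
qed

end
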